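(* Let $G$ be a weighted digraph with vertex set $V=\{1,\dots,n\}$, let $\alpha>0$ and $\beta=\frac1{1+\alpha}\in(0,1)$. Let $\wp$ be the pagerank vector of $G$ without teleporting (built from $S$) and $\wp_t$ the pagerank vector with teleporting (built from $S_t$), both with parameter $\alpha$. Let $L\subseteq V$ be the set of leaders (vertices with no incoming edges) and $R=V\setminus L$, and write $\wp=(\wp_L,\wp_R)$ and $\wp_t=(\wp_{t,L},\wp_{t,R})$ for the restrictions to $L$ and $R$. Then $$\wp_{t,L}=\left(\beta\pi_t+(1-\beta)\right)\wp_L,\qquad \wp_{t,R}=\left(\frac{\beta}{1-\beta}\,\pi_t+1\right)\wp_R,$$ where $\pi_t=\sum_{j\in L}\wp_t(j)$.
   Context: $G$ is a weakly connected (underlying undirected graph connected) weighted directed graph on $V=\{1,\dots,n\}$ with edge set $E\subseteq V\times V$; $ji\in E$ denotes an edge $j\to i$ with weight $w_{ji}>0$. The adjacency matrix $Q$ has $Q_{ij}=w_{ji}$ if $ji\in E$ and $0$ otherwise; thus $i\in L$ iff row $i$ of $Q$ is zero. The row stochastic matrix $S$ (no teleporting) is obtained by first replacing $Q_{ii}$ by $1$ in every zero row $i$ of $Q$ and then dividing each row by its sum. The row stochastic matrix $S_t$ (teleporting) is obtained by replacing every entry of each zero row of $Q$ by $1/n$ and then dividing each row by its sum. General notions, for a digraph with $N$ vertices and associated row stochastic matrix $A$ (for $i\neq j$: edge $j\to i$ iff $A_{ij}>0$): the reachable set $R(j)$ is $j$ together with all vertices reachable from $j$ by a directed path; a reach is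 an inclusion-maximal reachable set; let $R_1,\dots,R_k$ be the distinct reaches, $H_i=R_i\setminus\bigcup_{j\ne i}R_j$ the exclusive part, $C_i=R_i\setminus H_i$ the common part, and the cabal $B_i$ the set of $r\in R_i$ with $R(r)=R_i$. The right kernel of $I-A$ has a basis of column vectors $\gamma_1,\dots,\gamma_k$ with $\gamma_i=1$ on $H_i$, $\gamma_i\in(0,1)$ on $C_i$, $\gamma_i=0$ off $R_i$, $\sum_i\gamma_i=\mathbf 1$; the left kernel has a basis of row vectors $\bar\gamma_1,\dots,\bar\gamma_k$ that are nonnegative, have support $B_i$, and have entries summing to $1$. Let $\Gamma^0$ be the matrix with columns $\gamma_i$ and $\bar\Gamma^0$ the matrix with rows $\bar\gamma_i$. The influence of a vertex $v$ is $\frac1N\mathbf 1^T\,\Gamma^0\bar\Gamma^0\,\mathbf 1_{\{v\}}$, where $\mathbf 1_{\{v\}}$ is the standard basis column vector at $v$. Extended graph $E_\alpha[G]$ (for $\alpha>0$ and $P\in\{S,S_t\}$): start with the graph on $V$ with weighted adjacency matrix $P$, and for each $v\in V$ add one new vertex $b_v$ and one new edge $b_v\to v$ of weight $\alpha$. It has $2n$ vertices, and with the ordering $b_1,\dots,b_n,1,\dots,n$ its row stochastic matrix is $$\tilde S=\begin{pmatrix} I&0\\ \frac{\alpha}{1+\alpha}I&\frac1{1+\alpha}P\end{pmatrix}.$$ Its reaches are exactly $R(b_1),\dots,R(b_n)$. The pagerank vector is the row vector with entries $2\tilde I(b_v)-\frac1n$, $v\in V$, where $\tilde I(b_v)$ is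 the influence of $b_v$ in $E_\alpha[G]$ (with $N=2n$, $A=\tilde S$); it is $\wp$ when $P=S$ and $\wp_t$ when $P=S_t$. Equivalently, it is the unique probability vector $q$ with $q=\beta qP+\frac{1-\beta}{n}\mathbf 1^T$. *)

theory Defs
  imports "HOL-Analysis.Analysis"
begin

text \<open>The vertex set is a finite type \<open>'n\<close>, so that \<open>n = CARD('n)\<close>. A pair
  \<open>(j, i) \<in> E\<close> is the edge \<open>j \<rightarrow> i\<close>, of weight \<open>w j i\<close>. Loops are allowed, and a loop
  counts as an incoming edge.\<close>

definition weighted_digraph :: "('n \<times> 'n) set \<Rightarrow> ('n \<Rightarrow> 'n \<Rightarrow> real) \<Rightarrow> bool" where
  "weighted_digraph E w \<longleftrightarrow> (\<forall>(j, i) \<in> E. w j i > 0)"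

definition weakly_connected :: "('n \<times> 'n) set \<Rightarrow> bool" where
  "weakly_connected E \<longleftrightarrow> (\<forall>u v. (u, v) \<in> (E \<union> E\<inverse>)\<^sup>*)"

definition leaders :: "('n \<times> 'n) set \<Rightarrow> 'n set" where
  "leaders E = {i. \<nexists>j. (j, i) \<in> E}"

definition adjacency :: "('n::finite \<times> 'n) set \<Rightarrow> ('n \<Rightarrow> 'n \<Rightarrow> real) \<Rightarrow> real^'n^'n" where
  "adjacency E w = (\<chi> i j. if (j, i) \<in> E then w j i else 0)"

definition normalize_rows :: "real^'n^'n \<Rightarrow> real^'n^'n" where
  "normalize_rows M = (\<chi> i j. M $ i $ j / (\<Sum>k\<in>UNIV. M $ i $ k))"

definition stochastic :: "real^'n^'n \<Rightarrow> real^'n^'n" where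
  "stochastic Q = normalize_rows (\<chi> i j. if row i Q = 0 \<and> j = i then 1 else Q $ i $ j)"

definition stochastic_tele :: "real^'n^'n \<Rightarrow> real^'n^'n" where
  "stochastic_tele Q =
     normalize_rows (\<chi> i j. if row i Q = 0 then 1 / real CARD('n) else Q $ i $ j)"


subsection \<open>Reaches of the digraph of a row stochastic matrix\<close>

definition matrix_edges :: "real^'v^'v \<Rightarrow> ('v \<times> 'v) set" where
  "matrix_edges A = {(j, i). i \<noteq> j \<and> A $ i $ j > 0}"

definition reachable_set :: "real^'v^'v \<Rightarrow> 'v \<Rightarrow> 'v set" where
  "reachable_set A j = {i. (j, i) \<in> (matrix_edges A)\<^sup>*}"

definition reaches :: "real^'v^'v \<Rightarrow> 'v set set" where
  "reaches A = {X \<in> range (reachable_set A). \<forall>Y \<in> range (reachable_set A). X \<subseteq> Y \<longrightarrow> Y = X}"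

definition exclusive_part :: "real^'v^'v \<Rightarrow> 'v set \<Rightarrow> 'v set" where
  "exclusive_part A X = X - \<Union>(reaches A - {X})"

definition common_part :: "real^'v^'v \<Rightarrow> 'v set \<Rightarrow> 'v set" where
  "common_part A X = X - exclusive_part A X"

definition cabal :: "real^'v^'v \<Rightarrow> 'v set \<Rightarrow> 'v set" where
  "cabal A X = {r \<in> X. reachable_set A r = X}"


subsection \<open>Kernel bases and influence\<close>

text \<open>Both bases are families indexed by the reaches themselves instead of by an
  enumeration \<open>R\<^sub>1, \<dots>, R\<^sub>k\<close>; the injectivity requirement makes the family, and not
  just its image, linearly independent.\<close>

definition is_right_kernel_basis :: "real^'v^'v \<Rightarrow> ('v set \<Rightarrow> real^'v) \<Rightarrow> bool" where
  "is_right_kernel_basis A \<gamma> \<longleftrightarrow>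
     inj_on \<gamma> (reaches A) \<and> independent (\<gamma> ` reaches A) \<and>
     span (\<gamma> ` reaches A) = {x. (mat 1 - A) *v x = 0} \<and>
     (\<forall>X \<in> reaches A.
        (\<forall>u \<in> exclusive_part A X. \<gamma> X $ u = 1) \<and>
        (\<forall>u \<in> common_part A X. 0 < \<gamma> X $ u \<and> \<gamma> X $ u < 1) \<and>
        (\<forall>u. u \<notin> X \<longrightarrow> \<gamma> X $ u = 0)) \<and>
     (\<Sum>X\<in>reaches A. \<gamma> X) = 1"

definition is_left_kernel_basis :: "real^'v^'v \<Rightarrow> ('v set \<Rightarrow> real^'v) \<Rightarrow> bool" where
  "is_left_kernel_basis A \<gamma> \<longleftrightarrow>
     inj_on \<gamma> (reaches A) \<and> independent (\<gamma> ` reaches A) \<and>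
     span (\<gamma> ` reaches A) = {x. x v* (mat 1 - A) = 0} \<and>
     (\<forall>X \<in> reaches A.
        (\<forall>u. 0 \<le> \<gamma> X $ u) \<and>
        {u. \<gamma> X $ u \<noteq> 0} = cabal A X \<and>
        (\<Sum>u\<in>UNIV. \<gamma> X $ u) = 1)"

text \<open>For a row stochastic \<open>A\<close> such families exist and are determined on
  \<open>reaches A\<close>, the only place where they are used below.\<close>

definition right_kernel_basis :: "real^'v^'v \<Rightarrow> 'v set \<Rightarrow> real^'v" where
  "right_kernel_basis A = (SOME \<gamma>. is_right_kernel_basis A \<gamma>)"

definition left_kernel_basis :: "real^'v^'v \<Rightarrow> 'v set \<Rightarrow> real^'v" where
  "left_kernel_basis A = (SOME \<gamma>. is_left_kernel_basis A \<gamma>)"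

text \<open>The \<open>N \<times> N\<close> product of the matrix with columns \<open>right_kernel_basis A X\<close> and the
  matrix with rows \<open>left_kernel_basis A X\<close>; the inner index ranges over the reaches.\<close>

definition kernel_product :: "real^'v^'v \<Rightarrow> real^'v^'v" where
  "kernel_product A =
     (\<chi> u v. \<Sum>X\<in>reaches A. right_kernel_basis A X $ u * left_kernel_basis A X $ v)"

definition influence :: "real^'v^'v \<Rightarrow> 'v \<Rightarrow> real" where
  "influence A v = 1 / real CARD('v) * (1 \<bullet> (kernel_product A *v axis v 1))"


subsection \<open>Extended graph and pagerank\<close>

text \<open>\<open>Inl v\<close> is the added vertex \<open>b\<^sub>v\<close> and \<open>Inr v\<close> is the original vertex \<open>v\<close>.\<close>

definition extended_adjacency :: "real \<Rightarrow> real^'n^'n \<Rightarrow> real^('n + 'n)^('n + 'n)" where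
  "extended_adjacency \<alpha> P = (\<chi> x y. case x of
       Inl i \<Rightarrow> 0
     | Inr i \<Rightarrow> (case y of Inl j \<Rightarrow> (if j = i then \<alpha> else 0) | Inr j \<Rightarrow> P $ i $ j))"

definition extended_stochastic :: "real \<Rightarrow> real^'n^'n \<Rightarrow> real^('n + 'n)^('n + 'n)" where
  "extended_stochastic \<alpha> P = stochastic (extended_adjacency \<alpha> P)"

lemma extended_stochastic_block:
  fixes P :: "real^'n^'n"
  assumes "\<alpha> > 0" and P: "\<And>i. (\<Sum>j\<in>UNIV. P $ i $ j) = 1"
  shows "extended_stochastic \<alpha> P = (\<chi> x y. case x of
       Inl i \<Rightarrow> (if y = Inl i then 1 else 0)
     | Inr i \<Rightarrow> (case y of
           Inl j \<Rightarrow> (if j = i then \<alpha> / (1 + \<alpha>) else 0)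
         | Inr j \<Rightarrow> 1 / (1 + \<alpha>) * P $ i $ j))"
proof -
  let ?M = "extended_adjacency \<alpha> P"
  have zl: "row (Inl i) ?M = 0" for i
    by (simp add: row_def extended_adjacency_def vec_eq_iff)
  have zr: "row (Inr i) ?M \<noteq> 0" for i
  proof
    assume "row (Inr i) ?M = 0"
    then have "row (Inr i) ?M $ Inl i = 0" by simp
    with \<open>\<alpha> > 0\<close> show False by (simp add: row_def extended_adjacency_def)
  qed
  have split_sum: "(\<Sum>y\<in>UNIV. f y) = (\<Sum>j\<in>UNIV. f (Inl j)) + (\<Sum>j\<in>UNIV. f (Inr j))"
    for f :: "'n + 'n \<Rightarrow> real"
    by (simp add: UNIV_Plus_UNIV[symmetric] sum.Plus del: UNIV_Plus_UNIV)
  have m0: "?M $ Inl i $ y = 0" for i y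
    by (simp add: extended_adjacency_def)
  have el: "extended_stochastic \<alpha> P $ Inl i $ y = (if y = Inl i then 1 else 0)" for i y
    by (simp add: extended_stochastic_def stochastic_def normalize_rows_def zl m0 cong: if_cong)
  have "(\<Sum>y\<in>UNIV. ?M $ Inr i $ y) = 1 + \<alpha>" for i
    by (simp add: split_sum) (simp add: extended_adjacency_def P)
  then have er: "extended_stochastic \<alpha> P $ Inr i $ y = ?M $ Inr i $ y / (1 + \<alpha>)" for i y
    by (simp add: extended_stochastic_def stochastic_def normalize_rows_def zr)
  show ?thesis
    unfolding vec_eq_iff
  proof (intro allI)
    fix x y
    show "extended_stochastic \<alpha> P $ x $ y = (\<chi> x y. case x of
         Inl i \<Rightarrow> (if y = Inl i then 1 else 0)
       | Inr i \<Rightarrow> (case y of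
             Inl j \<Rightarrow> (if j = i then \<alpha> / (1 + \<alpha>) else 0)
           | Inr j \<Rightarrow> 1 / (1 + \<alpha>) * P $ i $ j)) $ x $ y"
      by (cases x; cases y) (simp_all add: el er, simp_all add: extended_adjacency_def)
  qed
qed

definition pagerank_of :: "real \<Rightarrow> real^'n^'n \<Rightarrow> real^'n" where
  "pagerank_of \<alpha> P =
     (\<chi> v. 2 * influence (extended_stochastic \<alpha> P) (Inl v) - 1 / real CARD('n))"

definition pagerank :: "('n::finite \<times> 'n) set \<Rightarrow> ('n \<Rightarrow> 'n \<Rightarrow> real) \<Rightarrow> real \<Rightarrow> real^'n" where
  "pagerank E w \<alpha> = pagerank_of \<alpha> (stochastic (adjacency E w))"

definition pagerank_tele :: "('n::finite \<times> 'n) set \<Rightarrow> ('n \<Rightarrow> 'n \<Rightarrow> real) \<Rightarrow> real \<Rightarrow> real^'n" where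
  "pagerank_tele E w \<alpha> = pagerank_of \<alpha> (stochastic_tele (adjacency E w))"

end

theory Submission
  imports Defs
begin

text \<open>
  Write \<open>n\<close> for the number of vertices. The proof rests on the description of the pagerank vector
  as the unique solution \<open>q\<close> of \<open>q = \<beta> q P + (1 - \<beta>) / n\<close>, applied to the two row stochastic
  matrices \<open>P\<close> of the graph. These have the same rows at the followers and differ only in the rows
  of the leaders. Let \<open>M\<close> be the common matrix with the leader rows set to zero. A leader keeps its own
  mass without teleporting, so \<open>q P\<close> is \<open>q M\<close> plus \<open>q\<close> restricted to the leaders; with teleporting it
  spreads its mass evenly, so \<open>q P\<close> is \<open>q M\<close> plus the constant \<open>\<pi>\<^sub>t / n\<close>. Hence the teleporting
  vector solves \<open>x - \<beta> x M = (\<beta> \<pi>\<^sub>t + (1 - \<beta>)) / n\<close>. The other vector, multiplied by \<open>1 - \<beta>\<close> at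
  the leaders, solves \<open>x - \<beta> x M = (1 - \<beta>) / n\<close>, because changing \<open>x\<close> at the leaders does not
  change \<open>x M\<close>. As \<open>I - \<beta> M\<close> is invertible, the two solutions are proportional, with factor
  \<open>\<beta> / (1 - \<beta>) \<pi>\<^sub>t + 1\<close>; this is the claim.

  The longer part derives the fixed point equation (\<open>pagerank_of_fixpoint\<close>) from the definition by
  influences in the extended graph. Every added vertex \<open>b\<^sub>v\<close> is a source and every original
  vertex is reached from one, so the reaches are the sets \<open>R(b\<^sub>v)\<close>, with cabal \<open>{b\<^sub>v}\<close>. The left
  kernel vector of \<open>R(b\<^sub>v)\<close> is therefore the unit vector at \<open>b\<^sub>v\<close>, and the right one is
  obtained by solving \<open>\<gamma> = (1 - \<beta>) \<one>\<^sub>v + \<beta> P \<gamma>\<close> on the original vertices: it is column \<open>v\<close> of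
  \<open>C = (1 - \<beta>) (I - \<beta> P)\<^sup>-\<^sup>1\<close>. That these families really are bases of the required kind
  (\<open>is_right_kernel_basis_exit_vector\<close>, \<open>is_left_kernel_basis_axis\<close>) has to be shown, since the
  definitions pick some such basis; that there is no other choice follows from the values at the added
  vertices. The pagerank vector is then the average of the rows of \<open>C\<close>, and
  \<open>C = (1 - \<beta>) I + \<beta> C P\<close> is the equation sought. The maximum principle for \<open>\<beta> P\<close> supplies
  invertibility as well as the signs and supports of the columns of \<open>C\<close>.
\<close>


section \<open>Damped substochastic matrices\<close>

locale damped_matrix =
  fixes M :: "real^'n^'n" and \<beta> :: real
  assumes nonneg: "0 \<le> M $ i $ j"
    and row_sum_le: "(\<Sum>j\<in>UNIV. M $ i $ j) \<le> 1"
    and \<beta>_pos: "0 < \<beta>" and \<beta>_less: "\<beta> < 1"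
begin

text \<open>At a vertex where \<open>x\<close> attains a positive maximum \<open>m\<close>, the damped average is at most \<open>\<beta> m < m\<close>.
  The inequality is required only where \<open>x\<close> is positive, so that \<open>x\<close> may be cut off to zero on a set
  of vertices; this is used to find the support of the columns of \<open>exit_matrix\<close>.\<close>

lemma maximum_principle:
  fixes x :: "'n \<Rightarrow> real"
  assumes x: "\<And>i. 0 < x i \<Longrightarrow> x i \<le> \<beta> * (\<Sum>j\<in>UNIV. M $ i $ j * x j)"
  shows "x i \<le> 0"
proof (rule ccontr)
  assume "\<not> x i \<le> 0"
  define m where "m = Max (range x)"
  have le: "x j \<le> m" for j
    by (simp add: m_def)
  have "m \<in> range x"
    unfolding m_def by (rule Max_in) auto
  then obtain k where k: "x k = m" by auto
  have m: "0 < m"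
    using le[of i] \<open>\<not> x i \<le> 0\<close> by simp
  have "(\<Sum>j\<in>UNIV. M $ k $ j * x j) \<le> (\<Sum>j\<in>UNIV. M $ k $ j * m)"
    by (intro sum_mono mult_left_mono le nonneg)
  also have "\<dots> = (\<Sum>j\<in>UNIV. M $ k $ j) * m"
    by (simp add: sum_distrib_right)
  also have "\<dots> \<le> m"
    using row_sum_le[of k] m by (simp add: mult_le_cancel_right2)
  finally have "\<beta> * (\<Sum>j\<in>UNIV. M $ k $ j * x j) \<le> \<beta> * m"
    using \<beta>_pos by simp
  also have "\<dots> < m"
    using \<beta>_less m by simp
  finally show False
    using x[of k] k m by simp
qed

lemma damped_mult_nth:
  "((mat 1 - \<beta> *\<^sub>R M) *v x) $ i = x $ i - \<beta> * (\<Sum>j\<in>UNIV. M $ i $ j * x $ j)"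
  by (simp add: matrix_vector_mult_diff_rdistrib scaleR_matrix_vector_assoc[symmetric])
     (simp add: matrix_vector_mult_def)

lemma damped_vector_mult_nth:
  "(x v* (mat 1 - \<beta> *\<^sub>R M)) $ j = x $ j - \<beta> * (\<Sum>i\<in>UNIV. x $ i * M $ i $ j)"
proof -
  have "(x v* (mat 1 - \<beta> *\<^sub>R M)) $ j
      = (\<Sum>i\<in>UNIV. (if i = j then x $ i else 0) - \<beta> * (x $ i * M $ i $ j))"
    by (simp add: vector_matrix_mult_def mat_def algebra_simps if_distrib cong: if_cong)
       (auto intro!: sum.cong simp: algebra_simps)
  then show ?thesis
    by (simp add: sum_subtractf sum_distrib_left)
qed

lemma right_fixpoint_eq_zero:
  fixes x :: "'n \<Rightarrow> real"
  assumes eq: "\<And>i. x i = \<beta> * (\<Sum>j\<in>UNIV. M $ i $ j * x j)"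
  shows "x i = 0"
proof -
  have "x i \<le> 0"
    by (rule maximum_principle) (rule eq_refl[OF eq])
  moreover have "- x i \<le> 0"
    by (rule maximum_principle[of "\<lambda>i. - x i"])
       (simp add: sum_negf, rule eq_refl[OF eq[symmetric]])
  ultimately show ?thesis by simp
qed

lemma invertible_damped: "invertible (mat 1 - \<beta> *\<^sub>R M)"
proof -
  have "x = 0" if "(mat 1 - \<beta> *\<^sub>R M) *v x = 0" for x
  proof -
    have "x $ i = \<beta> * (\<Sum>j\<in>UNIV. M $ i $ j * x $ j)" for i
      using damped_mult_nth[of x i] that by simp
    then have "x $ i = 0" for i
      by (rule right_fixpoint_eq_zero)
    then show "x = 0"
      by (simp add: vec_eq_iff)
  qed
  then show ?thesis
    using matrix_left_invertible_ker invertible_left_inverse by blast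
qed

lemma matrix_inv_damped:
  "(mat 1 - \<beta> *\<^sub>R M) ** matrix_inv (mat 1 - \<beta> *\<^sub>R M) = mat 1"
  "matrix_inv (mat 1 - \<beta> *\<^sub>R M) ** (mat 1 - \<beta> *\<^sub>R M) = mat 1"
  using someI_ex[OF invertible_damped[unfolded invertible_def]]
  unfolding matrix_inv_def by auto

text \<open>For row vectors there is no maximum principle, since the column sums of \<open>M\<close> are not bounded by
  one; invertibility carries uniqueness over from column vectors.\<close>

lemma left_fixpoint_eq_zero:
  assumes "\<And>j. x $ j = \<beta> * (\<Sum>i\<in>UNIV. x $ i * M $ i $ j)"
  shows "x = 0"
proof -
  have "x v* (mat 1 - \<beta> *\<^sub>R M) = 0"
    by (simp add: vec_eq_iff damped_vector_mult_nth flip: assms)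
  then have "x v* ((mat 1 - \<beta> *\<^sub>R M) ** matrix_inv (mat 1 - \<beta> *\<^sub>R M)) = 0"
    by (simp flip: vector_matrix_mul_assoc)
  then show ?thesis
    by (simp add: matrix_inv_damped)
qed

text \<open>Consider the walk that stops with probability \<open>1 - \<beta>\<close> before each step and otherwise moves from \<open>i\<close>
  to \<open>j\<close> with probability \<open>M $ i $ j\<close>. Entry \<open>(i, v)\<close> is the probability that the walk from \<open>i\<close> stops
  at \<open>v\<close>. The two lemmas that follow condition on the first and on the last step.\<close>

definition exit_matrix :: "real^'n^'n" where
  "exit_matrix = (1 - \<beta>) *\<^sub>R matrix_inv (mat 1 - \<beta> *\<^sub>R M)"

lemma exit_matrix_first_step:
  "exit_matrix $ i $ v =
     (if i = v then 1 - \<beta> else 0) + \<beta> * (\<Sum>j\<in>UNIV. M $ i $ j * exit_matrix $ j $ v)"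
proof -
  have "(mat 1 - \<beta> *\<^sub>R M) *v column v exit_matrix = (1 - \<beta>) *\<^sub>R axis v 1"
    unfolding exit_matrix_def
    by (simp add: matrix_vector_mul_assoc matrix_inv_damped matrix_vector_mult_scaleR
        flip: matrix_vector_mult_basis scaleR_matrix_vector_assoc)
  from arg_cong[OF this, of "\<lambda>x. x $ i"] show ?thesis
    by (simp add: damped_mult_nth column_def axis_def split: if_splits)
qed

lemma exit_matrix_last_step:
  "exit_matrix $ i $ v =
     (if i = v then 1 - \<beta> else 0) + \<beta> * (\<Sum>j\<in>UNIV. exit_matrix $ i $ j * M $ j $ v)"
proof -
  have "exit_matrix ** (mat 1 - \<beta> *\<^sub>R M) = (1 - \<beta>) *\<^sub>R mat 1"
    unfolding exit_matrix_def by (simp add: matrix_inv_damped flip: scalar_matrix_assoc)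
  moreover have "(exit_matrix ** (mat 1 - \<beta> *\<^sub>R M)) $ i
      = (exit_matrix $ i) v* (mat 1 - \<beta> *\<^sub>R M)"
    by (simp add: matrix_matrix_mult_def vector_matrix_mult_def vec_eq_iff mult.commute)
  ultimately have "((exit_matrix $ i) v* (mat 1 - \<beta> *\<^sub>R M)) $ v = ((1 - \<beta>) *\<^sub>R mat 1) $ i $ v"
    by simp
  then show ?thesis
    unfolding damped_vector_mult_nth by (simp add: mat_def split: if_splits)
qed

lemma exit_matrix_nonneg: "0 \<le> exit_matrix $ i $ v"
proof -
  have "- exit_matrix $ k $ v \<le> \<beta> * (\<Sum>j\<in>UNIV. M $ k $ j * (- exit_matrix $ j $ v))" for k
    using exit_matrix_first_step[of k v] \<beta>_less by (auto simp: sum_negf split: if_splits)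
  then have "- exit_matrix $ i $ v \<le> 0"
    by (intro maximum_principle)
  then show ?thesis by simp
qed

end


section \<open>Bases of subspaces with given coordinates\<close>

text \<open>Both kernels of the extended graph are determined by the coordinates \<open>e v\<close> at the added vertices, and
  the candidate families are dual to these coordinates. This alone makes such a family a basis.\<close>

lemma dual_family_basis:
  fixes f :: "'a::finite \<Rightarrow> real^'m" and e :: "'a \<Rightarrow> 'm"
  assumes S: "subspace S" "\<And>v. f v \<in> S"
    and dual: "\<And>u v. f v $ e u = (if u = v then 1 else 0)"
    and determined: "\<And>x. x \<in> S \<Longrightarrow> (\<And>v. x $ e v = 0) \<Longrightarrow> x = 0"
  shows "inj f" "independent (range f)" "span (range f) = S"
proof -
  show inj: "inj f"
    using dual by (metis injI zero_neq_one)
  have coord: "(\<Sum>v\<in>UNIV. c v *\<^sub>R f v) $ e u = c u" for c u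
    by (simp add: dual if_distrib cong: if_cong)
  show "independent (range f)"
  proof (rule independent_if_scalars_zero)
    fix c and y
    assume "(\<Sum>x\<in>range f. c x *\<^sub>R x) = 0" and "y \<in> range f"
    then show "c y = 0"
      using coord[of "c \<circ> f"] inj by (auto simp: sum.reindex)
  qed simp
  show "span (range f) = S"
  proof
    show "span (range f) \<subseteq> S"
      by (rule span_minimal) (use S in auto)
    show "S \<subseteq> span (range f)"
    proof
      fix x assume x: "x \<in> S"
      let ?y = "\<Sum>v\<in>UNIV. (x $ e v) *\<^sub>R f v"
      have "x - ?y = 0"
        using S x by (intro determined) (auto simp: coord intro!: subspace_diff subspace_sum subspace_mul
            simp del: sum_component)
      then have "x = ?y" by simp
      also have "\<dots> \<in> span (range f)"
        by (intro span_sum span_mul span_base) auto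
      finally show "x \<in> span (range f)" .
    qed
  qed
qed


section \<open>The extended graph\<close>

lemma vec_Plus_eq_iff:
  fixes x y :: "'c^('a::finite + 'b::finite)"
  shows "x = y \<longleftrightarrow> (\<forall>i. x $ Inl i = y $ Inl i) \<and> (\<forall>i. x $ Inr i = y $ Inr i)"
  by (simp add: vec_eq_iff split_sum_all)

lemma sum_UNIV_Plus:
  fixes f :: "'a::finite + 'b::finite \<Rightarrow> 'c::comm_monoid_add"
  shows "(\<Sum>y\<in>UNIV. f y) = (\<Sum>i\<in>UNIV. f (Inl i)) + (\<Sum>i\<in>UNIV. f (Inr i))"
  by (simp add: UNIV_Plus_UNIV[symmetric] sum.Plus del: UNIV_Plus_UNIV)

locale extended_graph = damped_matrix P \<beta> for P :: "real^'n^'n" and \<beta> +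
  fixes \<alpha> :: real
  assumes row_sum: "(\<Sum>j\<in>UNIV. P $ i $ j) = 1"
    and \<beta>_eq: "\<beta> = 1 / (1 + \<alpha>)"
begin

lemma \<alpha>_pos: "0 < \<alpha>"
  using \<beta>_pos \<beta>_less unfolding \<beta>_eq by (simp add: divide_simps split: if_splits)

abbreviation A :: "real^('n + 'n)^('n + 'n)" where
  "A \<equiv> extended_stochastic \<alpha> P"

lemma A_nth:
  "A $ Inl i $ y = (if y = Inl i then 1 else 0)"
  "A $ Inr i $ Inl j = (if j = i then 1 - \<beta> else 0)"
  "A $ Inr i $ Inr j = \<beta> * P $ i $ j"
  using \<alpha>_pos by (simp_all add: extended_stochastic_block[OF \<alpha>_pos row_sum] \<beta>_eq field_simps)

subsection \<open>Reaches\<close>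

abbreviation reach :: "'n \<Rightarrow> ('n + 'n) set" where
  "reach v \<equiv> reachable_set A (Inl v)"

text \<open>No edge enters an added vertex.\<close>

lemma Inl_mem_reachable_set: "Inl u \<in> reachable_set A x \<longleftrightarrow> x = Inl u"
proof
  assume "Inl u \<in> reachable_set A x"
  then have "(x, Inl u) \<in> (matrix_edges A)\<^sup>*"
    by (simp add: reachable_set_def)
  then show "x = Inl u"
    by (cases rule: rtranclE) (auto simp: matrix_edges_def A_nth split: if_splits)
qed (simp add: reachable_set_def)

lemma reachable_set_step: "y \<in> reachable_set A x \<Longrightarrow> 0 < A $ z $ y \<Longrightarrow> z \<in> reachable_set A x"
  unfolding reachable_set_def matrix_edges_def
  by (cases "z = y") (auto intro: rtrancl_into_rtrancl)

lemma Inr_mem_reach: "Inr v \<in> reach v"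
  by (rule reachable_set_step[of "Inl v"]) (use \<beta>_less in \<open>simp_all add: Inl_mem_reachable_set A_nth\<close>)

lemma inj_reach: "inj reach"
proof (rule injI)
  fix u v assume eq: "reach u = reach v"
  have "Inl u \<in> reach u"
    by (simp add: Inl_mem_reachable_set)
  then have "Inl u \<in> reach v"
    by (simp only: eq)
  then show "u = v"
    by (simp add: Inl_mem_reachable_set)
qed

text \<open>The set reachable from an original vertex \<open>i\<close> lies in \<open>R(b\<^sub>i)\<close> but omits \<open>b\<^sub>i\<close>, so it is not
  maximal; and a reachable set containing \<open>b\<^sub>v\<close> can only start at \<open>b\<^sub>v\<close>.\<close>

lemma reaches_eq: "reaches A = range reach"
proof (intro equalityI subsetI)
  fix X assume X: "X \<in> reaches A"
  then obtain x where x: "X = reachable_set A x"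
    by (auto simp: reaches_def)
  show "X \<in> range reach"
  proof (cases x)
    case (Inr i)
    have "X \<subseteq> reach i"
      using Inr_mem_reach[of i] unfolding x Inr reachable_set_def by auto
    then have "reach i = X"
      using X by (auto simp: reaches_def)
    then show ?thesis by blast
  qed (simp add: x)
next
  fix X assume "X \<in> range reach"
  then obtain v where v: "X = reach v" by blast
  have "Y = X" if Y: "Y \<in> range (reachable_set A)" "X \<subseteq> Y" for Y
  proof -
    obtain y where y: "Y = reachable_set A y"
      using Y by blast
    then have "Inl v \<in> reachable_set A y"
      using Y(2) Inl_mem_reachable_set[of v "Inl v"] unfolding v by blast
    then show "Y = X"
      by (simp add: Inl_mem_reachable_set v y)
  qed
  then show "X \<in> reaches A"
    unfolding reaches_def v by blast
qed

lemma cabal_reach: "cabal A (reach v) = {Inl v}"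
proof -
  have "r = Inl v" if "reachable_set A r = reach v" for r
    using Inl_mem_reachable_set[of v r] Inl_mem_reachable_set[of v "Inl v"] that by simp
  then show ?thesis
    by (auto simp: cabal_def Inl_mem_reachable_set)
qed

lemma exclusive_part_reach:
  "y \<in> exclusive_part A (reach v) \<longleftrightarrow> y \<in> reach v \<and> (\<forall>u. y \<in> reach u \<longrightarrow> u = v)"
proof -
  have "reach u \<noteq> reach v" if "u \<noteq> v" for u
    using that inj_reach by (auto dest: injD)
  then show ?thesis
    unfolding exclusive_part_def reaches_eq by blast
qed

lemma Inl_mem_exclusive_part: "Inl v \<in> exclusive_part A (reach v)"
  by (simp add: exclusive_part_reach Inl_mem_reachable_set)

subsection \<open>Kernels\<close>

lemma right_kernel_iff:
  "(mat 1 - A) *v x = 0 \<longleftrightarrow>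
     (\<forall>i. x $ Inr i = (1 - \<beta>) * x $ Inl i + \<beta> * (\<Sum>j\<in>UNIV. P $ i $ j * x $ Inr j))"
proof -
  have "(A *v x) $ Inl i = x $ Inl i" for i
    by (simp add: matrix_vector_mult_def A_nth if_distribR if_distrib cong: if_cong)
  moreover have "(A *v x) $ Inr i
      = (1 - \<beta>) * x $ Inl i + \<beta> * (\<Sum>j\<in>UNIV. P $ i $ j * x $ Inr j)" for i
    by (simp add: matrix_vector_mult_def sum_UNIV_Plus A_nth sum_distrib_left mult.assoc
        if_distribR if_distrib cong: if_cong)
  ultimately have "x = A *v x \<longleftrightarrow> (\<forall>i. x $ Inr i
      = (1 - \<beta>) * x $ Inl i + \<beta> * (\<Sum>j\<in>UNIV. P $ i $ j * x $ Inr j))"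
    by (simp add: vec_Plus_eq_iff)
  then show ?thesis
    by (simp add: matrix_vector_mult_diff_rdistrib)
qed

text \<open>With zero values at the added vertices the kernel equation becomes \<open>x = \<beta> P x\<close> on the original ones.\<close>

lemma right_kernel_determined:
  assumes "(mat 1 - A) *v x = 0" "\<And>v. x $ Inl v = 0"
  shows "x = 0"
proof -
  have "x $ Inr i = \<beta> * (\<Sum>j\<in>UNIV. P $ i $ j * x $ Inr j)" for i
    using assms(1)[unfolded right_kernel_iff, rule_format, of i] by (simp add: assms(2))
  then have "x $ Inr i = 0" for i
    by (rule right_fixpoint_eq_zero)
  then show ?thesis
    using assms(2) by (simp add: vec_Plus_eq_iff)
qed

text \<open>Column \<open>b\<^sub>j\<close> of the equation \<open>x = x A\<close> reads \<open>x b\<^sub>j = x b\<^sub>j + (1 - \<beta>) x j\<close>, which already forces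
  \<open>x j = 0\<close>.\<close>

lemma left_kernel_iff: "x v* (mat 1 - A) = 0 \<longleftrightarrow> (\<forall>i. x $ Inr i = 0)"
proof -
  have l: "(x v* A) $ Inl j = x $ Inl j + (1 - \<beta>) * x $ Inr j" for j
    by (simp add: vector_matrix_mult_def sum_UNIV_Plus A_nth if_distribR if_distrib mult.commute
        cong: if_cong)
  have r: "(x v* A) $ Inr j = \<beta> * (\<Sum>i\<in>UNIV. x $ Inr i * P $ i $ j)" for j
    by (simp add: vector_matrix_mult_def sum_UNIV_Plus A_nth sum_distrib_left mult_ac)
  have "x = x v* A \<longleftrightarrow> (\<forall>i. x $ Inr i = 0)"
    using \<beta>_less unfolding vec_Plus_eq_iff l r by auto
  then show ?thesis
    by (simp add: vector_matrix_mult_diff_rdistrib)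
qed

definition exit_vector :: "'n \<Rightarrow> real^('n + 'n)" where
  "exit_vector v = (\<chi> y. case y of Inl u \<Rightarrow> if u = v then 1 else 0 | Inr i \<Rightarrow> exit_matrix $ i $ v)"

lemma exit_vector_nth [simp]:
  "exit_vector v $ Inl u = (if u = v then 1 else 0)"
  "exit_vector v $ Inr i = exit_matrix $ i $ v"
  by (simp_all add: exit_vector_def)

lemma exit_vector_kernel: "(mat 1 - A) *v exit_vector v = 0"
proof (unfold right_kernel_iff, intro allI)
  fix i
  show "exit_vector v $ Inr i = (1 - \<beta>) * exit_vector v $ Inl i
      + \<beta> * (\<Sum>j\<in>UNIV. P $ i $ j * exit_vector v $ Inr j)"
    using exit_matrix_first_step[of i v] by simp
qed

lemma exit_vector_nonneg: "0 \<le> exit_vector v $ y"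
  by (cases y) (simp_all add: exit_matrix_nonneg)

text \<open>The sum and the constant vector \<open>1\<close> are kernel vectors with the same values at the added vertices.\<close>

lemma sum_exit_vector: "(\<Sum>v\<in>UNIV. exit_vector v) = 1"
proof -
  have "(mat 1 - A) *v ((\<Sum>v\<in>UNIV. exit_vector v) - 1) = 0"
  proof -
    have "(mat 1 - A) *v (\<Sum>v\<in>UNIV. exit_vector v) = 0"
      by (simp add: vec.sum exit_vector_kernel)
    moreover have "(mat 1 - A) *v 1 = 0"
      unfolding right_kernel_iff by (simp add: row_sum)
    ultimately show ?thesis
      by (simp only: matrix_vector_mult_diff_distrib diff_self)
  qed
  then have "(\<Sum>v\<in>UNIV. exit_vector v) - 1 = 0"
    by (rule right_kernel_determined) simp
  then show ?thesis by simp
qed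

text \<open>No edge leaves \<open>R(b\<^sub>v)\<close>, so outside it \<open>exit_vector v\<close> satisfies \<open>x = \<beta> P x\<close> with all terms from
  \<open>R(b\<^sub>v)\<close> missing; the maximum principle applies to \<open>x\<close> cut off to zero on \<open>R(b\<^sub>v)\<close>.\<close>

lemma exit_vector_off_reach:
  assumes "y \<notin> reach v"
  shows "exit_vector v $ y = 0"
proof (cases y)
  case (Inl u)
  then show ?thesis
    using assms by (auto simp: Inl_mem_reachable_set)
next
  case (Inr k)
  define x where "x i = (if Inr i \<in> reach v then 0 else exit_matrix $ i $ v)" for i
  have "x i \<le> \<beta> * (\<Sum>j\<in>UNIV. P $ i $ j * x j)" if "0 < x i" for i
  proof -
    have i: "Inr i \<notin> reach v"
      using that by (auto simp: x_def)
    have "P $ i $ j * exit_matrix $ j $ v = P $ i $ j * x j" for j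
    proof (cases "Inr j \<in> reach v")
      case True
      then have "P $ i $ j = 0"
        using i reachable_set_step[of "Inr j" "Inl v" "Inr i"] nonneg[of i j] \<beta>_pos
        by (simp add: A_nth) (metis less_eq_real_def mult_pos_pos)
      then show ?thesis by simp
    qed (simp add: x_def)
    then have "(\<Sum>j\<in>UNIV. P $ i $ j * exit_matrix $ j $ v) = (\<Sum>j\<in>UNIV. P $ i $ j * x j)"
      by (rule sum.cong[OF refl])
    moreover have "i \<noteq> v"
      using i Inr_mem_reach by blast
    moreover have "x i = exit_matrix $ i $ v"
      using i by (simp add: x_def)
    ultimately show ?thesis
      using exit_matrix_first_step[of i v] by simp
  qed
  then have "x k \<le> 0"
    by (rule maximum_principle)
  then show ?thesis
    using assms exit_matrix_nonneg[of k v] by (simp add: Inr x_def)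
qed

text \<open>Positivity starts at \<open>v\<close>, where the entry is at least \<open>1 - \<beta>\<close>, and passes along every edge \<open>j \<rightarrow> i\<close>
  because the entry at \<open>i\<close> is at least \<open>\<beta> P\<^sub>i\<^sub>j\<close> times the entry at \<open>j\<close>.\<close>

lemma exit_vector_pos_on_reach:
  assumes "y \<in> reach v"
  shows "0 < exit_vector v $ y"
proof -
  have "(Inl v, y) \<in> (matrix_edges A)\<^sup>*"
    using assms by (simp add: reachable_set_def)
  then show ?thesis
  proof induction
    case base
    then show ?case by simp
  next
    case (step y z)
    from step.hyps obtain i where z: "z = Inr i"
      by (cases z) (auto simp: matrix_edges_def A_nth split: if_splits)
    have sum: "0 \<le> (\<Sum>j\<in>UNIV. P $ i $ j * exit_matrix $ j $ v)"
      by (intro sum_nonneg mult_nonneg_nonneg nonneg exit_matrix_nonneg)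
    show ?case
    proof (cases y)
      case (Inl u)
      then have "u = i" "u = v"
        using step z by (auto simp: matrix_edges_def A_nth split: if_splits)
      then show ?thesis
        using exit_matrix_first_step[of i v] sum \<beta>_pos \<beta>_less z by (simp add: add_pos_nonneg)
    next
      case (Inr j)
      then have "0 < P $ i $ j"
        using step z \<beta>_pos by (auto simp: matrix_edges_def A_nth zero_less_mult_iff)
      then have "0 < P $ i $ j * exit_matrix $ j $ v"
        using step Inr by simp
      also have "\<dots> \<le> (\<Sum>j\<in>UNIV. P $ i $ j * exit_matrix $ j $ v)"
        by (rule member_le_sum) (simp_all add: nonneg exit_matrix_nonneg)
      finally show ?thesis
        using exit_matrix_first_step[of i v] \<beta>_pos \<beta>_less z by (simp add: add_nonneg_pos)
    qed
  qed
qed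

lemma sum_exit_vector_nth: "(\<Sum>v\<in>UNIV. exit_vector v $ y) = 1"
  using arg_cong[OF sum_exit_vector, of "\<lambda>x. x $ y"] by simp

text \<open>The values at \<open>y\<close> sum to one over all \<open>v\<close>, and in the exclusive part only one of them is nonzero. In
  the common part at least two are positive, so each is less than one.\<close>

lemma exit_vector_on_exclusive_part:
  assumes "y \<in> exclusive_part A (reach v)"
  shows "exit_vector v $ y = 1"
proof -
  have "exit_vector u $ y = 0" if "u \<noteq> v" for u
    using assms that by (intro exit_vector_off_reach) (auto simp: exclusive_part_reach)
  then have "(\<Sum>u\<in>UNIV. exit_vector u $ y) = exit_vector v $ y"
    by (subst sum.remove[of _ v]) auto
  then show ?thesis
    by (simp add: sum_exit_vector_nth)
qed

lemma exit_vector_on_common_part: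
  assumes "y \<in> common_part A (reach v)"
  shows "0 < exit_vector v $ y" "exit_vector v $ y < 1"
proof -
  show "0 < exit_vector v $ y"
    using assms by (intro exit_vector_pos_on_reach) (simp add: common_part_def)
  obtain u where u: "u \<noteq> v" "y \<in> reach u"
    using assms by (auto simp: common_part_def exclusive_part_reach)
  have "exit_vector v $ y + exit_vector u $ y = (\<Sum>w\<in>{v, u}. exit_vector w $ y)"
    using u by simp
  also have "\<dots> \<le> (\<Sum>w\<in>UNIV. exit_vector w $ y)"
    by (intro sum_mono2) (auto simp: exit_vector_nonneg)
  finally show "exit_vector v $ y < 1"
    using exit_vector_pos_on_reach[OF u(2)] by (simp add: sum_exit_vector_nth)
qed

subsection \<open>Kernel bases\<close>

lemma inv_reach [simp]: "inv reach (reach v) = v"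
  by (rule inv_f_f[OF inj_reach])

lemma image_reaches: "(\<lambda>X. f (inv reach X)) ` reaches A = range f"
  by (auto simp: reaches_eq image_image)

lemma sum_reaches: "(\<Sum>X\<in>reaches A. f X) = (\<Sum>v\<in>UNIV. f (reach v))"
  by (simp add: reaches_eq sum.reindex[OF inj_reach])

lemma inj_on_reaches: "inj f \<Longrightarrow> inj_on (\<lambda>X. f (inv reach X)) (reaches A)"
  by (auto simp: reaches_eq intro!: inj_onI dest: injD)

lemma is_right_kernel_basis_exit_vector:
  "is_right_kernel_basis A (\<lambda>X. exit_vector (inv reach X))"
proof -
  have "subspace {x. (mat 1 - A) *v x = 0}"
    by (rule linear_subspace_kernel) simp
  note basis = dual_family_basis[OF this, of exit_vector Inl]
  have "inj exit_vector" "independent (range exit_vector)"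
    "span (range exit_vector) = {x. (mat 1 - A) *v x = 0}"
    by (rule basis; use right_kernel_determined in \<open>auto simp: exit_vector_kernel\<close>)+
  then show ?thesis
    unfolding is_right_kernel_basis_def image_reaches sum_reaches
    using inj_on_reaches[of exit_vector]
    by (auto simp: reaches_eq sum_exit_vector exit_vector_on_exclusive_part
        exit_vector_on_common_part exit_vector_off_reach)
qed

lemma is_left_kernel_basis_axis:
  "is_left_kernel_basis A (\<lambda>X. axis (Inl (inv reach X)) 1)"
proof -
  let ?f = "\<lambda>v. axis (Inl v) 1 :: real^('n + 'n)"
  have "subspace {x. x v* (mat 1 - A) = 0}"
    by (auto simp: subspace_def left_kernel_iff)
  note basis = dual_family_basis[OF this, of ?f Inl]
  have "x = 0" if "x v* (mat 1 - A) = 0" "\<And>v. x $ Inl v = 0" for x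
    using that unfolding left_kernel_iff by (simp add: vec_Plus_eq_iff)
  then have "inj ?f" "independent (range ?f)" "span (range ?f) = {x. x v* (mat 1 - A) = 0}"
    by - (rule basis; auto simp: left_kernel_iff axis_def)+
  then show ?thesis
    unfolding is_left_kernel_basis_def image_reaches[of ?f]
    using inj_on_reaches[of ?f]
    by (auto simp: reaches_eq cabal_reach axis_def)
qed

text \<open>\<open>b\<^sub>u\<close> lies in the exclusive part of its own reach and in no other reach, so every admissible basis has
  the same values at the added vertices as \<open>exit_vector\<close>, and these determine kernel vectors.\<close>

lemma right_kernel_basis_reach: "right_kernel_basis A (reach v) = exit_vector v"
proof -
  let ?\<gamma> = "right_kernel_basis A"
  have basis: "is_right_kernel_basis A ?\<gamma>"
    unfolding right_kernel_basis_def by (rule someI[of "is_right_kernel_basis A", OF is_right_kernel_basis_exit_vector])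
  have X: "reach v \<in> reaches A"
    by (simp add: reaches_eq)
  then have "?\<gamma> (reach v) \<in> span (?\<gamma> ` reaches A)"
    by (intro span_base) simp
  then have "(mat 1 - A) *v ?\<gamma> (reach v) = 0"
    using basis unfolding is_right_kernel_basis_def by blast
  then have kernel: "(mat 1 - A) *v (?\<gamma> (reach v) - exit_vector v) = 0"
    by (simp add: matrix_vector_mult_diff_distrib exit_vector_kernel)
  have coord: "?\<gamma> (reach v) $ Inl u = (if u = v then 1 else 0)" for u
    using basis X Inl_mem_exclusive_part[of v] unfolding is_right_kernel_basis_def
    by (auto simp: Inl_mem_reachable_set)
  have "(?\<gamma> (reach v) - exit_vector v) $ Inl u = 0" for u
    unfolding vector_minus_component coord by simp
  with kernel have "?\<gamma> (reach v) - exit_vector v = 0"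
    by (rule right_kernel_determined)
  then show ?thesis by simp
qed

lemma left_kernel_basis_reach: "left_kernel_basis A (reach v) = axis (Inl v) 1"
proof -
  let ?x = "left_kernel_basis A (reach v)"
  have "is_left_kernel_basis A (left_kernel_basis A)"
    unfolding left_kernel_basis_def by (rule someI[of "is_left_kernel_basis A", OF is_left_kernel_basis_axis])
  then have supp: "{u. ?x $ u \<noteq> 0} = {Inl v}" and sum: "(\<Sum>u\<in>UNIV. ?x $ u) = 1"
    unfolding is_left_kernel_basis_def by (auto simp: reaches_eq cabal_reach)
  have zero: "?x $ u = 0" if "u \<noteq> Inl v" for u
    using supp that by blast
  then have "(\<Sum>u\<in>UNIV. ?x $ u) = ?x $ Inl v"
    by (subst sum.remove[of _ "Inl v"]) auto
  then show ?thesis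
    using zero sum by (auto simp: vec_eq_iff axis_def)
qed

subsection \<open>Pagerank\<close>

text \<open>In column \<open>b\<^sub>v\<close> of the kernel product only the reach \<open>R(b\<^sub>v)\<close> contributes, as the left kernel vectors
  are unit vectors. The summand \<open>1\<close> is the entry of \<open>exit_vector v\<close> at \<open>b\<^sub>v\<close>; in the pagerank vector
  it is cancelled by the subtracted \<open>1 / n\<close>.\<close>

lemma influence_Inl:
  "influence A (Inl v) = (1 + (\<Sum>i\<in>UNIV. exit_matrix $ i $ v)) / (2 * real CARD('n))"
proof -
  have "(kernel_product A *v axis (Inl v) 1) $ y = exit_vector v $ y" for y
  proof -
    have "(kernel_product A *v axis (Inl v) 1) $ y
        = (\<Sum>u\<in>UNIV. exit_vector u $ y * (axis (Inl u) 1 :: real^('n + 'n)) $ Inl v)"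
      by (simp add: matrix_vector_mult_basis column_def kernel_product_def sum_reaches
          right_kernel_basis_reach left_kernel_basis_reach)
    also have "\<dots> = (\<Sum>u\<in>UNIV. if u = v then exit_vector u $ y else 0)"
      by (rule sum.cong) (auto simp: axis_def)
    finally show ?thesis by simp
  qed
  then have "1 \<bullet> (kernel_product A *v axis (Inl v) 1) = (\<Sum>y\<in>UNIV. exit_vector v $ y)"
    by (simp add: inner_vec_def)
  then show ?thesis
    by (simp add: influence_def sum_UNIV_Plus)
qed

lemma pagerank_of_nth:
  "pagerank_of \<alpha> P $ v = (\<Sum>i\<in>UNIV. exit_matrix $ i $ v) / real CARD('n)"
  by (simp add: pagerank_of_def influence_Inl field_simps)

lemma pagerank_of_fixpoint:
  "pagerank_of \<alpha> P $ v =
     \<beta> * (\<Sum>j\<in>UNIV. pagerank_of \<alpha> P $ j * P $ j $ v) + (1 - \<beta>) / real CARD('n)"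
proof -
  have "(\<Sum>i\<in>UNIV. exit_matrix $ i $ v)
      = (\<Sum>i\<in>UNIV. (if i = v then 1 - \<beta> else 0) + \<beta> * (\<Sum>j\<in>UNIV. exit_matrix $ i $ j * P $ j $ v))"
    by (intro sum.cong refl exit_matrix_last_step)
  also have "\<dots> = (1 - \<beta>) + \<beta> * (\<Sum>i\<in>UNIV. \<Sum>j\<in>UNIV. exit_matrix $ i $ j * P $ j $ v)"
    by (simp add: sum.distrib sum_distrib_left)
  also have "(\<Sum>i\<in>UNIV. \<Sum>j\<in>UNIV. exit_matrix $ i $ j * P $ j $ v)
      = (\<Sum>j\<in>UNIV. (\<Sum>i\<in>UNIV. exit_matrix $ i $ j) * P $ j $ v)"
    by (subst sum.swap) (simp add: sum_distrib_right)
  finally show ?thesis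
    by (simp add: pagerank_of_nth add_divide_distrib flip: sum_divide_distrib)
qed

end


section \<open>Pagerank with and without teleporting\<close>

text \<open>The rows of leaders come out as zero because \<open>0 / 0 = 0\<close>; the other rows are those of both stochastic
  matrices.\<close>

definition follower_matrix :: "('n::finite \<times> 'n) set \<Rightarrow> ('n \<Rightarrow> 'n \<Rightarrow> real) \<Rightarrow> real^'n^'n" where
  "follower_matrix E w = normalize_rows (adjacency E w)"

lemma row_adjacency_eq_zero_iff:
  assumes "weighted_digraph E w"
  shows "row i (adjacency E w) = 0 \<longleftrightarrow> i \<in> leaders E"
proof -
  have "w j i \<noteq> 0" if "(j, i) \<in> E" for j
    using assms that by (auto simp: weighted_digraph_def)
  then show ?thesis
    by (auto simp: row_def adjacency_def vec_eq_iff leaders_def)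
qed

lemma follower_matrix_nonneg:
  assumes "weighted_digraph E w"
  shows "0 \<le> follower_matrix E w $ i $ j"
proof -
  have "0 \<le> adjacency E w $ i $ k" for k
    using assms by (auto simp: adjacency_def weighted_digraph_def intro: less_imp_le)
  then show ?thesis
    by (simp add: follower_matrix_def normalize_rows_def sum_nonneg)
qed

lemma follower_matrix_leader:
  "i \<in> leaders E \<Longrightarrow> follower_matrix E w $ i $ j = 0"
  by (simp add: follower_matrix_def normalize_rows_def adjacency_def leaders_def)

lemma follower_matrix_row_sum:
  assumes "weighted_digraph E w" "i \<notin> leaders E"
  shows "(\<Sum>j\<in>UNIV. follower_matrix E w $ i $ j) = 1"
proof -
  obtain k where "(k, i) \<in> E"
    using assms by (auto simp: leaders_def)
  then have "0 < (\<Sum>k\<in>UNIV. adjacency E w $ i $ k)"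
    using assms(1)
    by (intro sum_pos2[of _ k]) (auto simp: adjacency_def weighted_digraph_def intro: less_imp_le)
  then show ?thesis
    by (simp add: follower_matrix_def normalize_rows_def flip: sum_divide_distrib)
qed

lemma stochastic_adjacency_nth:
  assumes "weighted_digraph E w"
  shows "stochastic (adjacency E w) $ i $ j =
    (if i \<in> leaders E then if j = i then 1 else 0 else follower_matrix E w $ i $ j)"
proof (cases "i \<in> leaders E")
  case True
  then have "adjacency E w $ i $ k = 0" for k
    by (simp add: adjacency_def leaders_def)
  then show ?thesis
    using True by (simp add: stochastic_def normalize_rows_def row_adjacency_eq_zero_iff[OF assms]
        cong: if_cong)
next
  case False
  then show ?thesis
    by (simp add: stochastic_def normalize_rows_def follower_matrix_def
        row_adjacency_eq_zero_iff[OF assms])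
qed

lemma stochastic_tele_adjacency_nth:
  fixes E :: "('n::finite \<times> 'n) set"
  assumes "weighted_digraph E w"
  shows "stochastic_tele (adjacency E w) $ i $ j =
    (if i \<in> leaders E then 1 / real CARD('n) else follower_matrix E w $ i $ j)"
  by (simp add: stochastic_tele_def normalize_rows_def follower_matrix_def
      row_adjacency_eq_zero_iff[OF assms])

theorem proposition6p3:
  fixes E :: "('n::finite \<times> 'n) set"
    and w :: "'n \<Rightarrow> 'n \<Rightarrow> real"
    and \<alpha> \<beta> \<pi>\<^sub>t :: real
  assumes "weighted_digraph E w"
    and "weakly_connected E"
    and "\<alpha> > 0"
    and "\<beta> = 1 / (1 + \<alpha>)"
    and "\<pi>\<^sub>t = (\<Sum>j\<in>leaders E. pagerank_tele E w \<alpha> $ j)"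
  shows "(\<forall>i \<in> leaders E.
            pagerank_tele E w \<alpha> $ i = (\<beta> * \<pi>\<^sub>t + (1 - \<beta>)) * pagerank E w \<alpha> $ i) \<and>
         (\<forall>i \<in> UNIV - leaders E.
            pagerank_tele E w \<alpha> $ i = (\<beta> / (1 - \<beta>) * \<pi>\<^sub>t + 1) * pagerank E w \<alpha> $ i)"
proof -
  let ?L = "leaders E" and ?M = "follower_matrix E w"
  let ?q = "pagerank E w \<alpha>" and ?qt = "pagerank_tele E w \<alpha>" and ?n = "real CARD('n)"
  note entries = stochastic_adjacency_nth[OF assms(1)] stochastic_tele_adjacency_nth[OF assms(1)]
    follower_matrix_nonneg[OF assms(1)] follower_matrix_row_sum[OF assms(1)]
  have \<beta>: "0 < \<beta>" "\<beta> < 1"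
    using assms(3,4) by simp_all
  interpret G: extended_graph "stochastic (adjacency E w)" \<beta> \<alpha>
  proof
    show "(\<Sum>j\<in>UNIV. stochastic (adjacency E w) $ i $ j) = 1" for i
      by (cases "i \<in> ?L") (simp_all add: entries)
    then show "(\<Sum>j\<in>UNIV. stochastic (adjacency E w) $ i $ j) \<le> 1" for i
      by simp
  qed (use \<beta> assms(4) in \<open>simp_all add: entries\<close>)
  interpret T: extended_graph "stochastic_tele (adjacency E w)" \<beta> \<alpha>
  proof
    show "(\<Sum>j\<in>UNIV. stochastic_tele (adjacency E w) $ i $ j) = 1" for i
      by (cases "i \<in> ?L") (simp_all add: entries)
    then show "(\<Sum>j\<in>UNIV. stochastic_tele (adjacency E w) $ i $ j) \<le> 1" for i
      by simp
  qed (use \<beta> assms(4) in \<open>simp_all add: entries\<close>)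
  interpret M: damped_matrix ?M \<beta>
  proof
    show "(\<Sum>j\<in>UNIV. ?M $ i $ j) \<le> 1" for i
      by (cases "i \<in> ?L") (simp_all add: entries follower_matrix_leader)
  qed (use \<beta> in \<open>simp_all add: entries\<close>)
  have q: "(if v \<in> ?L then (1 - \<beta>) * ?q $ v else ?q $ v)
      = \<beta> * (\<Sum>i\<in>UNIV. ?q $ i * ?M $ i $ v) + (1 - \<beta>) / ?n" for v
  proof -
    have "(\<Sum>i\<in>UNIV. ?q $ i * stochastic (adjacency E w) $ i $ v)
        = (\<Sum>i\<in>UNIV. ?q $ i * ?M $ i $ v + (if i = v then if v \<in> ?L then ?q $ v else 0 else 0))"
      by (rule sum.cong) (auto simp: entries follower_matrix_leader)
    also have "\<dots> = (\<Sum>i\<in>UNIV. ?q $ i * ?M $ i $ v) + (if v \<in> ?L then ?q $ v else 0)"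
      by (simp add: sum.distrib)
    finally have "?q $ v = \<beta> * ((\<Sum>i\<in>UNIV. ?q $ i * ?M $ i $ v)
        + (if v \<in> ?L then ?q $ v else 0)) + (1 - \<beta>) / ?n"
      using G.pagerank_of_fixpoint[of v, folded pagerank_def] by (rule subst)
    then show ?thesis
      unfolding left_diff_distrib distrib_left by (auto split: if_split_asm)
  qed
  have qt: "?qt $ v = \<beta> * (\<Sum>i\<in>UNIV. ?qt $ i * ?M $ i $ v) + (\<beta> * \<pi>\<^sub>t + (1 - \<beta>)) / ?n" for v
  proof -
    have "(\<Sum>i\<in>UNIV. ?qt $ i * stochastic_tele (adjacency E w) $ i $ v)
        = (\<Sum>i\<in>UNIV. ?qt $ i * ?M $ i $ v + (if i \<in> ?L then ?qt $ i / ?n else 0))"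
      by (rule sum.cong) (auto simp: entries follower_matrix_leader)
    also have "\<dots> = (\<Sum>i\<in>UNIV. ?qt $ i * ?M $ i $ v) + \<pi>\<^sub>t / ?n"
      by (simp add: sum.distrib assms(5) sum_divide_distrib flip: sum.inter_filter)
    finally show ?thesis
      using T.pagerank_of_fixpoint[of v, folded pagerank_tele_def]
      by (simp add: distrib_left add_divide_distrib)
  qed
  \<comment> \<open>the factor at the followers; at the leaders it is multiplied by \<open>1 - \<beta>\<close>\<close>
  define c where "c = \<beta> / (1 - \<beta>) * \<pi>\<^sub>t + 1"
  have c: "(1 - \<beta>) * c = \<beta> * \<pi>\<^sub>t + (1 - \<beta>)"
    using \<beta> by (simp add: c_def field_simps)
  define r where "r = (\<chi> v. c * (if v \<in> ?L then (1 - \<beta>) * ?q $ v else ?q $ v))"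
  have r: "r $ v = \<beta> * (\<Sum>i\<in>UNIV. r $ i * ?M $ i $ v) + (\<beta> * \<pi>\<^sub>t + (1 - \<beta>)) / ?n" for v
  proof -
    have "(\<Sum>i\<in>UNIV. r $ i * ?M $ i $ v) = c * (\<Sum>i\<in>UNIV. ?q $ i * ?M $ i $ v)"
      unfolding sum_distrib_left by (rule sum.cong) (auto simp: r_def follower_matrix_leader)
    moreover have "r $ v = c * (\<beta> * (\<Sum>i\<in>UNIV. ?q $ i * ?M $ i $ v) + (1 - \<beta>) / ?n)"
      unfolding q[symmetric] by (simp add: r_def)
    ultimately show ?thesis
      unfolding c[symmetric] by (simp add: algebra_simps)
  qed
  have "?qt - r = 0"
  proof (rule M.left_fixpoint_eq_zero)
    show "(?qt - r) $ v = \<beta> * (\<Sum>i\<in>UNIV. (?qt - r) $ i * ?M $ i $ v)" for v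
      using qt[of v] r[of v] by (simp add: left_diff_distrib sum_subtractf right_diff_distrib)
  qed
  then have "?qt = r" by simp
  then show ?thesis
    unfolding c[symmetric] c_def[symmetric] by (simp add: r_def mult_ac)
qed

end
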